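(* Let $\varepsilon,\delta>0$ be constants, let $u_->u_+$ be real numbers, and assume $$\frac14<\frac{\delta(u_--u_+)}{2\varepsilon^2}<A\le1 .$$ Let $\tilde u$ be the associated viscous-dispersive shock, with local extremal values $u_0,u_1,u_2,\dots$ indexed from right to left. Then $$u_0-u_-\le\frac{u_--u_+}{2}\cdot\frac{1}{100A}\Big(\sqrt{9+25(\sqrt{1+4A}-1)^2}-3\Big)^2 .$$ Moreover, the amplitudes of the oscillations $|u_i-u_-|$ decay exponentially, in the sense that there are constants $\rho_*>1$ and $\rho^*>1$ depending only on $A$ such that for every odd positive integer $i$, $$\frac{u_{i-1}-u_-}{u_--u_i}\ge\rho_*>1\qquad\text{and}\qquad\frac{u_--u_i}{u_{i+1}-u_-}\ge\rho^*>1,$$ where for the following selected values of $A$ the decay rates are given by: $A=\frac13$: $\rho_*=6.05$, $\rho^*=6.14$; $A=\frac12$: $\rho_*=4.64$, $\rho^*=4.77$; $A=\frac23$: $\rho_*=3.89$, $\rho^*=4.06$; $A=\frac34$: $\rho_*=3.63$, $\rho^*=3.81$; $A=1$: $\rho_*=3.10$, $\rho^*=3.30$.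
   Context: Viscous-dispersive shock: with $\sigma=\frac{u_-+u_+}{2}$, a smooth function $\tilde u=\tilde u(\xi)$ on $\mathbb R$ solving $$-\sigma\tilde u'+\big(\tfrac12\tilde u^2\big)'=\varepsilon\tilde u''-\delta\tilde u''',\qquad \lim_{\xi\to\pm\infty}\tilde u(\xi)=u_\pm,\qquad \lim_{\xi\to\pm\infty}\tilde u'(\xi)=0 .$$ It exists and is unique up to translation. When $\frac{\delta(u_--u_+)}{2\varepsilon^2}>\frac14$ it oscillates around $u_-$ infinitely many times as $\xi\to-\infty$. Notation for extrema: the points where local extrema of $\tilde u$ are attained are $\xi_0>\xi_1>\xi_2>\cdots$, indexed from right to left ($\xi_0$ is the rightmost), and $u_i=\tilde u(\xi_i)$. Thus $\tilde u$ is decreasing on $(\xi_0,+\infty)$; $u_i>u_-$ is a local maximum for even $i$ and $u_i<u_-$ is a local minimum for odd $i$; $\tilde u$ is increasing on $(\xi_i,\xi_{i-1})$ for odd $i$ and decreasing on it for even $i\ge2$. *)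

theory Defs
  imports "HOL-Analysis.Analysis"
begin

text \<open>
  \<open>um\<close> and \<open>up\<close> are the left and right end states \<open>u\<^sub>-\<close> and \<open>u\<^sub>+\<close>. The first conjunct is
  \<open>C\<^sup>\<infinity>\<close> smoothness: all iterated derivatives exist everywhere. In particular no \<open>deriv\<close>
  in the equation is a junk value.
\<close>

definition viscous_dispersive_shock :: "real \<Rightarrow> real \<Rightarrow> real \<Rightarrow> real \<Rightarrow> (real \<Rightarrow> real) \<Rightarrow> bool" where
  "viscous_dispersive_shock \<epsilon> \<delta> um up u \<longleftrightarrow>
     (\<forall>k x. (deriv ^^ k) u differentiable (at x)) \<and>
     (\<forall>x. - ((um + up) / 2) * deriv u x + deriv (\<lambda>y. (u y)\<^sup>2 / 2) x =
           \<epsilon> * deriv (deriv u) x - \<delta> * deriv (deriv (deriv u)) x) \<and>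
     (u \<longlongrightarrow> um) at_bot \<and> (u \<longlongrightarrow> up) at_top \<and>
     (deriv u \<longlongrightarrow> 0) at_bot \<and> (deriv u \<longlongrightarrow> 0) at_top"

definition local_extremum_at :: "(real \<Rightarrow> real) \<Rightarrow> real \<Rightarrow> bool" where
  "local_extremum_at u x \<longleftrightarrow>
     (\<forall>\<^sub>F y in at x. u y \<le> u x) \<or> (\<forall>\<^sub>F y in at x. u x \<le> u y)"

text \<open>
  \<open>\<xi> 0 > \<xi> 1 > \<dots>\<close> lists all points at which a local extremum is attained, so \<open>\<xi> 0\<close> is the
  rightmost one.
\<close>

definition extrema_from_right :: "(real \<Rightarrow> real) \<Rightarrow> (nat \<Rightarrow> real) \<Rightarrow> bool" where
  "extrema_from_right u \<xi> \<longleftrightarrow>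
     (\<forall>i j. i < j \<longrightarrow> \<xi> j < \<xi> i) \<and> range \<xi> = {x. local_extremum_at u x}"

end

theory Submission
  imports Defs
begin

text \<open>
  Integrating once and rescaling turns the profile equation into the damped oscillator
  \<open>k v'' = v' - v - v\<^sup>2/2\<close> with \<open>k = \<delta> (u\<^sub>- - u\<^sub>+) / (2 \<epsilon>\<^sup>2)\<close>, whose trajectory runs from the focus \<open>v = 0\<close>
  to the saddle \<open>v = -2\<close>. The energy \<open>k v'\<^sup>2/2 + v\<^sup>2/2 + v\<^sup>3/6\<close> increases from \<open>0\<close> to \<open>2/3\<close>, which confines
  the trajectory to \<open>-2 < v < 1\<close> and makes maxima above \<open>0\<close> and minima below \<open>0\<close> alternate.

  All quantitative bounds come from one comparison principle in the phase plane. Let the speed be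
  \<open>q = |v'|\<close> on a monotone piece and let \<open>h(v)\<close> be a barrier such that \<open>k h\<^sup>2/2\<close>, differentiated in the
  direction of motion, is at most the value that the equation prescribes at speed \<open>h\<close>. Then \<open>q\<^sup>2 - h\<^sup>2\<close> increases with \<open>x\<close> as long as it is positive.
  It vanishes at the right end of the piece, so \<open>q \<le> h\<close>, and the swing cannot pass a zero of \<open>h\<close>.
  For the decay ratios \<open>h\<^sup>2\<close> is a cubic polynomial in \<open>v\<close>; for the first peak \<open>h\<close> is \<open>v + 2\<close> times a cubic
  polynomial in \<open>sqrt (r - v)\<close>, \<open>r\<close> being the claimed bound.
\<close>

section \<open>Damped half swings\<close>

text \<open>A sign condition on the derivative only where \<open>W\<close> is positive suffices: up
  to a first point with \<open>W\<close> nonpositive, \<open>W\<close> would not decrease from its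
  positive initial value, so there is no such point.\<close>

lemma persistent_positive:
  fixes W W' :: "real \<Rightarrow> real"
  assumes ab: "a \<le> b"
    and der: "\<And>x. a \<le> x \<Longrightarrow> x \<le> b \<Longrightarrow> (W has_real_derivative W' x) (at x)"
    and pos: "W a > 0"
    and incr: "\<And>x. a < x \<Longrightarrow> x < b \<Longrightarrow> W x > 0 \<Longrightarrow> W' x \<ge> 0"
  shows "W a \<le> W b"
proof -
  have cont: "continuous_on {a..b} W"
    using der by (meson DERIV_isCont atLeastAtMost_iff continuous_at_imp_continuous_on)
  have le: "W a \<le> W y"
    if y: "a \<le> y" "y \<le> b" and pos_before: "\<And>x. a < x \<Longrightarrow> x < y \<Longrightarrow> W x > 0" for y
    using y(1)
  proof (rule DERIV_nonneg_imp_increasing_open)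
    fix x assume "a < x" "x < y"
    then show "\<exists>d. (W has_real_derivative d) (at x) \<and> 0 \<le> d"
      using der incr pos_before y by (meson less_eq_real_def order.trans not_le)
  next
    show "continuous_on {a..y} W"
      using cont y by (auto intro: continuous_on_subset)
  qed
  have "W x > 0" if x: "a < x" "x < b" for x
  proof (rule ccontr)
    assume "\<not> W x > 0"
    define T where "T = {a..b} \<inter> W -` {..0}"
    have "closed T"
      unfolding T_def by (rule continuous_closed_preimage[OF cont]) auto
    moreover have "bounded T"
      unfolding T_def by (rule bounded_subset[of "{a..b}"]) auto
    ultimately have "compact T"
      by (simp add: compact_eq_bounded_closed)
    moreover have "x \<in> T"
      using \<open>\<not> W x > 0\<close> x by (auto simp: T_def)
    ultimately obtain y where y: "y \<in> T" "\<And>t. t \<in> T \<Longrightarrow> y \<le> t"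
      using compact_attains_inf[of T] by auto
    have "W a \<le> W y"
    proof (rule le)
      fix t assume "a < t" "t < y"
      then have "t \<notin> T" using y(2) by fastforce
      then show "W t > 0" using \<open>a < t\<close> \<open>t < y\<close> y(1) by (auto simp: T_def)
    qed (use y(1) in \<open>auto simp: T_def\<close>)
    then show False using y(1) pos by (auto simp: T_def)
  qed
  then show ?thesis using le[of b] ab by auto
qed

text \<open>
  For \<open>x\<close> running backwards, \<open>Y\<close> swings from \<open>a = Y x1 > 0\<close> to a negative value. In units of \<open>a\<close>
  the squared speed is compared with the cubic \<open>(1 - y) (y + 1/\<rho>) (l0 + l1 y) / k\<close>. The identity
  asks for the slopes at \<open>y = 1\<close> and \<open>y = -1/\<rho>\<close> that the equation forces where the speed vanishes;
  \<open>\<eta>\<close> bounds the contribution of the quadratic term of the force.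
\<close>

definition admissible_ratio :: "real \<Rightarrow> real \<Rightarrow> real \<Rightarrow> bool" where
  "admissible_ratio \<eta> A \<rho> \<longleftrightarrow> \<rho> > 0 \<and> (\<exists>l0 l1 \<kappa>. \<forall>y.
     ((1 / \<rho>) * l1 + (1 - 1 / \<rho>) * l0) / 2 + ((1 - 1 / \<rho>) * l1 - l0) * y - 3 * l1 * y\<^sup>2 / 2
        + y + \<eta> * y\<^sup>2 / 2 = \<kappa> * ((1 - y) * (y + 1 / \<rho>)) \<and>
     A * \<kappa>\<^sup>2 * ((1 - y) * (y + 1 / \<rho>)) \<le> l0 + l1 * y)"

text \<open>Let \<open>a = Y x1\<close>. If \<open>Y x0\<close> lay below
  \<open>- a / \<rho>\<close>, \<open>Y\<close> would cross that level at some \<open>s\<close> with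
  positive speed, while the cubic vanishes there. The excess \<open>W\<close> would be positive at
  \<open>s\<close> and not decrease, yet it is \<open>0\<close> at \<open>x1\<close>. The sign
  \<open>\<theta>\<close> is \<open>1\<close> for \<open>Y = v\<close> and \<open>- 1\<close> for
  \<open>Y = - v\<close>.\<close>

lemma half_swing:
  fixes Y P :: "real \<Rightarrow> real"
  assumes x: "x0 < x1" and c: "c > 0" and k: "0 < k" "k \<le> A"
    and dY: "\<And>x. (Y has_real_derivative c * P x) (at x)"
    and dP: "\<And>x. (P has_real_derivative c * ((P x - Y x - \<theta> * (Y x)\<^sup>2 / 2) / k)) (at x)"
    and Ppos: "\<And>x. x0 < x \<Longrightarrow> x < x1 \<Longrightarrow> P x > 0" and P1: "P x1 = 0"
    and Y1: "Y x1 > 0" "\<theta> * Y x1 \<le> \<eta>"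
    and adm: "admissible_ratio \<eta> A \<rho>"
  shows "- Y x0 * \<rho> \<le> Y x1"
proof (rule ccontr)
  define e where e: "e = 1 / \<rho>"
  have \<rho>: "\<rho> > 0" using adm by (simp add: admissible_ratio_def)
  obtain l0 l1 \<kappa> where
    slopes: "\<And>y. (e * l1 + (1 - e) * l0) / 2 + ((1 - e) * l1 - l0) * y - 3 * l1 * y\<^sup>2 / 2
        + y + \<eta> * y\<^sup>2 / 2 = \<kappa> * ((1 - y) * (y + e))"
    and below: "\<And>y. A * \<kappa>\<^sup>2 * ((1 - y) * (y + e)) \<le> l0 + l1 * y"
    using adm unfolding admissible_ratio_def e by blast
  assume "\<not> - Y x0 * \<rho> \<le> Y x1"
  define a where "a = Y x1"
  have a: "a > 0" using Y1 by (simp add: a_def)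
  have e0: "e > 0" using \<rho> e by simp
  have far: "Y x0 < - (a * e)"
    using \<open>\<not> - Y x0 * \<rho> \<le> Y x1\<close> \<rho> by (simp add: a_def e field_simps)
  have contY: "isCont Y x" for x
    using dY DERIV_isCont by blast
  obtain s where s: "x0 \<le> s" "s \<le> x1" "Y s = - (a * e)"
  proof -
    have "\<exists>s\<ge>x0. s \<le> x1 \<and> Y s = - (a * e)"
      using far x a e0 by (intro IVT) (auto simp: a_def[symmetric] contY intro: order.trans[of _ 0])
    then show ?thesis using that by blast
  qed
  have sx: "x0 < s" "s < x1"
    using s far a e0 by (auto simp: less_le a_def)
       (smt (verit) mult_pos_pos)
  \<comment> \<open>\<open>F'\<close> is the derivative of the cubic rewritten by the slope
    identity; its force terms cancel those of the equation of motion up to the estimate by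
    \<open>\<eta>\<close>.\<close>
  define F where "F y = (1 - y) * (y + e) * (l0 + l1 * y)" for y
  define F' where "F' y = 2 * (\<kappa> * ((1 - y) * (y + e)) - y - \<eta> * y\<^sup>2 / 2)" for y
  have dF: "(F has_real_derivative F' y) (at y)" for y
  proof -
    have "(F has_real_derivative ((- 1) * (y + e) + (1 - y)) * (l0 + l1 * y) + (1 - y) * (y + e) * l1) (at y)"
      unfolding F_def by (auto intro!: derivative_eq_intros simp: algebra_simps)
    moreover have "((- 1) * (y + e) + (1 - y)) * (l0 + l1 * y) + (1 - y) * (y + e) * l1 = F' y"
      unfolding F'_def slopes[symmetric] by (simp add: field_simps power2_eq_square)
    ultimately show ?thesis by simp
  qed
  define W where "W x = k * (P x)\<^sup>2 / 2 - a\<^sup>2 * F (Y x / a) / 2" for x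
  define W' where "W' x = c * P x * (P x - Y x - \<theta> * (Y x)\<^sup>2 / 2 - a * F' (Y x / a) / 2)" for x
  have dW: "(W has_real_derivative W' x) (at x)" for x
  proof -
    have "((\<lambda>x. F (Y x / a)) has_real_derivative F' (Y x / a) * (c * P x / a)) (at x)"
      using a by (intro DERIV_chain2[OF dF]) (auto intro!: derivative_eq_intros dY)
    then show ?thesis
      unfolding W_def W'_def using k(1) a
      by (auto intro!: derivative_eq_intros dP simp: divide_simps power2_eq_square)
         (auto simp: algebra_simps)
  qed
  have Y_mono: "Y t \<le> Y t'" if t: "s \<le> t" "t \<le> t'" "t' \<le> x1" for t t'
  proof (rule DERIV_nonneg_imp_nondecreasing[OF t(2)])
    fix w assume w: "t \<le> w" "w \<le> t'"
    have "P w \<ge> 0"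
      using Ppos[of w] P1 w t sx by (cases "w = x1") auto
    then show "\<exists>D. (Y has_real_derivative D) (at w) \<and> 0 \<le> D"
      using dY[of w] c by (intro exI[of _ "c * P w"]) simp
  qed
  have mono: "Y s \<le> Y x" "Y x \<le> Y x1" if "s < x" "x < x1" for x
    using Y_mono that by auto
  have "W s \<le> W x1"
  proof (rule persistent_positive[where W = W and W' = W'])
    show "W s > 0"
      using s a k Ppos[OF sx] by (simp add: W_def F_def)
    fix x assume x: "s < x" "x < x1" and Wx: "W x > 0"
    define y where "y = Y x / a"
    define X where "X = (1 - y) * (y + e)"
    have Px: "P x > 0" using Ppos x sx by simp
    have y: "Y x = a * y" "- e \<le> y" "y \<le> 1"
      using mono[OF x] a s by (auto simp: y_def a_def[symmetric] field_simps)
    have X: "X \<ge> 0" using y by (simp add: X_def)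
    have Xle: "k * \<kappa>\<^sup>2 * X \<le> l0 + l1 * y"
      using below[of y] k X mult_right_mono[of k A "\<kappa>\<^sup>2 * X"] by (simp add: X_def mult.assoc)
    \<comment> \<open>While \<open>W x > 0\<close>, the second admissibility condition turns the
      excess into the pointwise bound \<open>a * (\<kappa> * X) \<le> P x\<close>, which is what
      \<open>W' x \<ge> 0\<close> needs.\<close>
    have "k * (a * (\<kappa> * X))\<^sup>2 \<le> k * (P x)\<^sup>2"
    proof -
      have "k * (a * (\<kappa> * X))\<^sup>2 = a\<^sup>2 * X * (k * \<kappa>\<^sup>2 * X)"
        by (simp add: power2_eq_square)
      also have "\<dots> \<le> a\<^sup>2 * X * (l0 + l1 * y)"
        using Xle X by (intro mult_left_mono) auto
      also have "\<dots> = a\<^sup>2 * F y"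
        by (simp add: F_def X_def)
      also have "\<dots> \<le> k * (P x)\<^sup>2"
        using Wx by (simp add: W_def y_def)
      finally show ?thesis .
    qed
    then have "(a * (\<kappa> * X))\<^sup>2 \<le> (P x)\<^sup>2"
      using k by simp
    then have "a * (\<kappa> * X) \<le> P x"
      by (rule power2_le_imp_le) (use Px in auto)
    moreover have "\<theta> * (Y x)\<^sup>2 \<le> a * (\<eta> * y\<^sup>2)"
    proof -
      have "\<theta> * (Y x)\<^sup>2 = a * ((\<theta> * a) * y\<^sup>2)" using y by (simp add: power2_eq_square)
      also have "\<dots> \<le> a * (\<eta> * y\<^sup>2)"
        using Y1 a by (intro mult_left_mono mult_right_mono) (auto simp: a_def)
      finally show ?thesis .
    qed
    moreover have "a * F' (Y x / a) / 2 = a * (\<kappa> * X) - Y x - a * (\<eta> * y\<^sup>2) / 2"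
    proof -
      have "F' y = 2 * (\<kappa> * X - y - \<eta> * y\<^sup>2 / 2)"
        by (simp add: F'_def X_def)
      then have "a * F' (Y x / a) / 2 = a * (\<kappa> * X - y - \<eta> * y\<^sup>2 / 2)"
        unfolding y_def[symmetric] by simp
      then show ?thesis
        using y(1) by (simp add: algebra_simps)
    qed
    ultimately show "W' x \<ge> 0"
      using Px c by (simp add: W'_def)
  qed (use sx dW in auto)
  moreover have "W s > 0" "W x1 = 0"
    using s a k Ppos[OF sx] P1 by (simp_all add: W_def F_def a_def)
  ultimately show False by simp
qed

section \<open>The first peak\<close>

definition profile :: "real \<Rightarrow> real \<Rightarrow> real \<Rightarrow> real \<Rightarrow> real" where
  "profile c1 c2 c3 x = x * (c1 + c2 * x + c3 * x\<^sup>2)"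

text \<open>
  The barrier for \<open>-p\<close> is \<open>h = (v + 2) m \<omega>(x)\<close> with \<open>\<omega>\<close> the profile and \<open>v = r - (2 + r) x\<^sup>2\<close>, so that
  \<open>h\<close> vanishes like a square root at the candidate peak \<open>r = n S\<^sup>2\<close>. Divided by \<open>v + 2\<close>, the barrier
  inequality \<open>k h h' + v + v\<^sup>2/2 + h \<ge> 0\<close> becomes \<open>profile_defect \<ge> 0\<close>, where \<open>m\<close> is the slope of the
  trajectory at the rest point \<open>v = -2\<close>, and \<open>n = 1 - m = k m\<^sup>2\<close>.
\<close>

definition profile_defect :: "real \<Rightarrow> real \<Rightarrow> real \<Rightarrow> real \<Rightarrow> real \<Rightarrow> real \<Rightarrow> real" where
  "profile_defect c1 c2 c3 S n x =
     n * ((profile c1 c2 c3 x)\<^sup>2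
       - (1 - x\<^sup>2) * (c1 + c2 * x + c3 * x\<^sup>2) * (c1 + 2 * c2 * x + 3 * c3 * x\<^sup>2) / 2)
     + (1 - n) * profile c1 c2 c3 x + n * S\<^sup>2 * (1 - x\<^sup>2) / 2 - x\<^sup>2"

text \<open>If \<open>v x0\<close> exceeded \<open>r\<close>, the trajectory would cross the level
  \<open>r\<close> with nonzero speed, where the barrier is zero. The excess \<open>W\<close> would
  be positive just after the crossing and never decrease, but it tends to \<open>0\<close> because
  \<open>p\<close> and \<open>h (v x)\<close> both do.\<close>

lemma first_peak:
  fixes v p :: "real \<Rightarrow> real"
  assumes c: "c > 0" and k: "k > 0" and m: "m > 0" "k * m\<^sup>2 = 1 - m"
    and dv: "\<And>x. (v has_real_derivative c * p x) (at x)"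
    and dp: "\<And>x. (p has_real_derivative c * ((p x - v x - (v x)\<^sup>2 / 2) / k)) (at x)"
    and v_lim: "(v \<longlongrightarrow> - 2) at_top" and p_lim: "(p \<longlongrightarrow> 0) at_top"
    and v_gt: "\<And>x. v x > - 2" and p_neg: "\<And>x. x > x0 \<Longrightarrow> p x < 0"
    and S: "S > 0" and n: "n = 1 - m" "n > 0"
    and defect: "\<And>x. 0 < x \<Longrightarrow> x < 1 \<Longrightarrow> profile_defect c1 c2 c3 S n x \<ge> 0"
  shows "v x0 \<le> n * S\<^sup>2"
proof (rule ccontr)
  define r where "r = n * S\<^sup>2"
  assume "\<not> v x0 \<le> n * S\<^sup>2"
  then have vr: "v x0 > r" by (simp add: r_def)
  have r: "r > 0" using n S by (simp add: r_def)
  define N where "N = 2 + r"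
  have N: "N > 0" using r by (simp add: N_def)
  define \<omega> where "\<omega> = profile c1 c2 c3"
  \<comment> \<open>\<open>\<sigma>\<close> sends the candidate peak \<open>r\<close> to
    \<open>0\<close> and the rest point \<open>- 2\<close> to \<open>1\<close>.\<close>
  define \<sigma> where "\<sigma> y = sqrt ((r - y) / N)" for y
  define h where "h y = (y + 2) * m * \<omega> (\<sigma> y)" for y
  define W where "W x = k * ((p x)\<^sup>2 - (h (v x))\<^sup>2) / 2" for x
  have contv: "isCont v x" and contp: "isCont p x" for x
    using dv dp DERIV_isCont by blast+
  have conth: "isCont h y" for y
    unfolding h_def \<omega>_def profile_def \<sigma>_def using N by (intro continuous_intros) auto
  have contW: "isCont W x" for x
    unfolding W_def using isCont_o2[OF contv conth] contp by (intro continuous_intros) auto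
  have "\<forall>\<^sub>F x in at_top. v x < r"
    using r by (intro order_tendstoD[OF v_lim]) auto
  then obtain X where X: "\<And>x. x \<ge> X \<Longrightarrow> v x < r"
    unfolding eventually_at_top_linorder by blast
  have "x0 < X" using X[of x0] vr by force
  then have "\<exists>x1\<ge>x0. x1 \<le> X \<and> v x1 = r"
    using vr X[of X] contv by (intro IVT2) auto
  then obtain x1 where x1: "x0 < x1" "v x1 = r"
    using vr less_le by blast
  have "h r = 0" by (simp add: h_def \<sigma>_def \<omega>_def profile_def)
  then have "W x1 > 0"
    using k p_neg[OF x1(1)] x1(2) by (simp add: W_def)
  then have "\<forall>\<^sub>F x in at x1. W x > 0"
    using contW[of x1] by (intro order_tendstoD) (auto simp: isCont_def)
  then obtain d where d: "d > 0" "\<And>x. x \<noteq> x1 \<Longrightarrow> dist x x1 < d \<Longrightarrow> W x > 0"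
    unfolding eventually_at by blast
  \<comment> \<open>Moving slightly to the right of \<open>x1\<close> avoids \<open>v = r\<close>,
    where the square root is not differentiable.\<close>
  define x2 where "x2 = x1 + d / 2"
  have x2: "x1 < x2" "W x2 > 0"
    using d by (auto simp: x2_def dist_real_def)
  have v_less: "v x < r" if "x \<ge> x2" for x
  proof -
    have "v x < v x1"
    proof (rule DERIV_neg_imp_decreasing[of x1 x v])
      fix t assume "x1 \<le> t"
      then have "c * p t < 0"
        using c p_neg[of t] x1 by (intro mult_pos_neg) auto
      then show "\<exists>D. (v has_real_derivative D) (at t) \<and> D < 0"
        using dv by blast
    qed (use that x2 in simp)
    then show ?thesis using x1 by simp
  qed
  have W_ge: "W x2 \<le> W x" if "x \<ge> x2" for x
  proof -
    define h' where "h' y = m * \<omega> (\<sigma> y)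
      - (y + 2) * m * (c1 + 2 * c2 * \<sigma> y + 3 * c3 * (\<sigma> y)\<^sup>2) / (2 * N * \<sigma> y)" for y
    define W' where "W' t = c * p t * (p t - v t - (v t)\<^sup>2 / 2 - k * h (v t) * h' (v t))" for t
    have dW: "(W has_real_derivative W' t) (at t)" if "t \<ge> x2" for t
    proof -
      have vt: "v t < r" using v_less that by simp
      have dh: "(h has_real_derivative h' y) (at y)" if "y < r" for y
      proof -
        have \<sigma>: "\<sigma> y > 0" using that N by (simp add: \<sigma>_def)
        have "(\<sigma> has_real_derivative - 1 / (2 * N * \<sigma> y)) (at y)"
          unfolding \<sigma>_def using that N
          by (auto intro!: derivative_eq_intros simp: field_simps)
        moreover have "(\<omega> has_real_derivative c1 + 2 * c2 * x + 3 * c3 * x\<^sup>2) (at x)" for x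
          unfolding \<omega>_def profile_def
          by (auto intro!: derivative_eq_intros simp: algebra_simps power2_eq_square)
        ultimately have "((\<lambda>y. \<omega> (\<sigma> y)) has_real_derivative
            (c1 + 2 * c2 * \<sigma> y + 3 * c3 * (\<sigma> y)\<^sup>2) * (- 1 / (2 * N * \<sigma> y))) (at y)"
          by (intro DERIV_chain2)
        from DERIV_mult[OF DERIV_cmult_right[OF DERIV_add[OF DERIV_ident DERIV_const]] this]
        show ?thesis
          unfolding h_def h'_def
          by (rule DERIV_cong) simp
      qed
      have "((\<lambda>x. h (v x)) has_real_derivative h' (v t) * (c * p t)) (at t)"
        by (rule DERIV_chain2[OF dh[OF vt] dv])
      then show ?thesis
        unfolding W_def W'_def using k
        by (auto intro!: derivative_eq_intros dp simp: divide_simps power2_eq_square)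
           (auto simp: algebra_simps)
    qed
    show ?thesis
    proof (rule persistent_positive[where W = W and W' = W'])
      fix t assume t: "x2 < t" "t < x" and Wt: "W t > 0"
      define z where "z = \<sigma> (v t)"
      have pt: "p t < 0" using p_neg t x1 x2 by simp
      have vt: "v t < r" using v_less t by simp
      have z0: "z > 0" using vt N by (simp add: z_def \<sigma>_def)
      have z2: "z\<^sup>2 = (r - v t) / N" using vt N by (simp add: z_def \<sigma>_def)
      have vz: "v t = r - N * z\<^sup>2" using z2 N by simp
      have s: "v t + 2 = N * (1 - z\<^sup>2)" using vz by (simp add: N_def algebra_simps)
      have z1: "z < 1"
      proof -
        have "N * (1 - z\<^sup>2) > 0" using s v_gt[of t] by simp
        then have "z\<^sup>2 < 1\<^sup>2" using N by (simp add: zero_less_mult_iff)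
        then show ?thesis by (rule power2_less_imp_less) simp
      qed
      have "(h (v t))\<^sup>2 < (p t)\<^sup>2" using Wt k by (simp add: W_def zero_less_mult_iff)
      then have "(h (v t))\<^sup>2 < (- p t)\<^sup>2" by simp
      then have "h (v t) < - p t"
        by (rule power2_less_imp_less) (use pt in simp)
      \<comment> \<open>The barrier inequality with \<open>v + 2\<close> factored out. Together with
        \<open>h (v t) < - p t\<close> it makes the second factor of \<open>W' t\<close>
        nonpositive, and \<open>p t\<close> is negative too.\<close>
      moreover have "v t + (v t)\<^sup>2 / 2 + k * h (v t) * h' (v t) + h (v t)
          = (v t + 2) * profile_defect c1 c2 c3 S n z"
      proof -
        have "h' (v t) = m * (\<omega> z - (1 - z\<^sup>2) * (c1 + 2 * c2 * z + 3 * c3 * z\<^sup>2) / (2 * z))"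
          unfolding h'_def z_def[symmetric] s using N z0 by (simp add: field_simps)
        then have "k * h (v t) * h' (v t) = (v t + 2) * (k * m\<^sup>2) * (\<omega> z *
           (\<omega> z - (1 - z\<^sup>2) * (c1 + 2 * c2 * z + 3 * c3 * z\<^sup>2) / (2 * z)))"
          by (simp add: h_def z_def[symmetric] power2_eq_square)
        also have "\<omega> z * (\<omega> z - (1 - z\<^sup>2) * (c1 + 2 * c2 * z + 3 * c3 * z\<^sup>2) / (2 * z))
          = (\<omega> z)\<^sup>2 - (1 - z\<^sup>2) * (c1 + c2 * z + c3 * z\<^sup>2) * (c1 + 2 * c2 * z + 3 * c3 * z\<^sup>2) / 2"
          using z0 by (simp add: \<omega>_def profile_def field_simps power2_eq_square)
        finally have kh: "k * h (v t) * h' (v t) = (v t + 2) * (n * ((\<omega> z)\<^sup>2 - (1 - z\<^sup>2) *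
            (c1 + c2 * z + c3 * z\<^sup>2) * (c1 + 2 * c2 * z + 3 * c3 * z\<^sup>2) / 2))"
          by (simp add: m n mult.assoc)
        have hh: "h (v t) = (v t + 2) * ((1 - n) * \<omega> z)"
          by (simp add: h_def z_def n mult.assoc)
        have half: "v t / 2 = n * S\<^sup>2 * (1 - z\<^sup>2) / 2 - z\<^sup>2"
          using vz by (simp add: N_def r_def algebra_simps)
        have vv: "v t + (v t)\<^sup>2 / 2 = (v t + 2) * (n * S\<^sup>2 * (1 - z\<^sup>2) / 2 - z\<^sup>2)"
          unfolding half[symmetric] by (simp add: power2_eq_square field_simps)
        show ?thesis
          unfolding kh unfolding hh vv profile_defect_def \<omega>_def by (simp only: algebra_simps)
      qed
      moreover have "(v t + 2) * profile_defect c1 c2 c3 S n z \<ge> 0"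
        using v_gt[of t] defect[OF z0 z1] by simp
      ultimately have "p t - v t - (v t)\<^sup>2 / 2 - k * h (v t) * h' (v t) \<le> 0"
        by linarith
      then show "W' t \<ge> 0"
        unfolding W'_def using pt c by (intro mult_nonpos_nonpos) (auto simp: mult_pos_neg less_imp_le)
    qed (use that x2 dW in auto)
  qed
  have "(W \<longlongrightarrow> k * (0\<^sup>2 - (h (- 2))\<^sup>2) / 2) at_top"
    unfolding W_def using isCont_tendsto_compose[OF conth v_lim] p_lim by (intro tendsto_intros) auto
  then have "(W \<longlongrightarrow> 0) at_top" by (simp add: h_def)
  then have "W x2 \<le> 0"
    by (rule tendsto_lowerbound) (auto intro: eventually_at_top_linorderI[of x2] W_ge)
  then show False using x2 by simp
qed

section \<open>Positivity of the profile defect\<close>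

lemma profile_defect_nonneg_between:
  assumes "n1 \<le> n" "n \<le> n2"
    and "profile_defect c1 c2 c3 S n1 x \<ge> 0" "profile_defect c1 c2 c3 S n2 x \<ge> 0"
  shows "profile_defect c1 c2 c3 S n x \<ge> 0"
proof (cases "n1 < n2")
  case True
  define a where "a = profile c1 c2 c3 x - x\<^sup>2"
  define b where "b = (profile c1 c2 c3 x)\<^sup>2
    - (1 - x\<^sup>2) * (c1 + c2 * x + c3 * x\<^sup>2) * (c1 + 2 * c2 * x + 3 * c3 * x\<^sup>2) / 2
    - profile c1 c2 c3 x + S\<^sup>2 * (1 - x\<^sup>2) / 2"
  \<comment> \<open>For fixed \<open>x\<close> the defect is affine in \<open>n\<close>, so its
    signs at the two ends of the range suffice.\<close>
  have affine: "profile_defect c1 c2 c3 S t x = a + t * b" for t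
    by (simp add: profile_defect_def a_def b_def algebra_simps)
  have "0 \<le> (n2 - n) * (a + n1 * b) + (n - n1) * (a + n2 * b)"
    using assms by (simp add: affine)
  also have "\<dots> = (n2 - n1) * (a + n * b)"
    by (simp add: algebra_simps)
  finally show ?thesis
    using True by (simp add: affine zero_le_mult_iff)
next
  case False
  then have "n = n1" using assms by simp
  then show ?thesis using assms by simp
qed

text \<open>
  The four profiles were found by numerical search. Each positivity certificate is the Bernstein
  form of the defect on \<open>[0, 1]\<close>, \<open>[0, 1/2]\<close> or \<open>[1/2, 1]\<close>.
\<close>

lemma profile_defect_nonneg_1:
  assumes x: "0 \<le> x" "x \<le> 1" and n: "69/200 \<le> n" "n \<le> 191/500"
  shows "profile_defect (14/25) (83/100) (-19/50) (29/50) n x \<ge> 0"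
proof (rule profile_defect_nonneg_between[OF n])
  show "profile_defect (14/25) (83/100) (-19/50) (29/50) (69/200) x \<ge> 0"
  proof -
    have "2000000 * profile_defect (14/25) (83/100) (-19/50) (29/50) (69/200) x =
      7866 * (1 - x)^6
        + 299728 * x * (1 - x)^5
        + 494791 * x^2 * (1 - x)^4
        + 307961 * x^3 * (1 - x)^3
        + 1048327 * x^4 * (1 - x)^2
        + 721174 * x^5 * (1 - x)
        + 26969 * x^6"
      unfolding profile_defect_def profile_def by (simp add: field_simps) algebra
    moreover have "\<dots> \<ge> 0" using x by (intro add_nonneg_nonneg mult_nonneg_nonneg zero_le_power) auto
    ultimately show ?thesis by simp
  qed
  show "profile_defect (14/25) (83/100) (-19/50) (29/50) (191/500) x \<ge> 0"
  proof (cases "x \<le> 1/2")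
    case True
    have "5000000 * profile_defect (14/25) (83/100) (-19/50) (29/50) (191/500) x =
      21774 * (1 - 2 * x)^6
        + 660036 * x * (1 - 2 * x)^5
        + 2932919 * x^2 * (1 - 2 * x)^4
        + 3984775 * x^3 * (1 - 2 * x)^3
        + 1687814 * x^4 * (1 - 2 * x)^2
        + 1454229 * x^5 * (1 - 2 * x)
        + 1525824 * x^6"
      unfolding profile_defect_def profile_def by (simp add: field_simps) algebra
    moreover have "\<dots> \<ge> 0" using x True by (intro add_nonneg_nonneg mult_nonneg_nonneg zero_le_power) auto
    ultimately show ?thesis by simp
  next
    case False
    have "5000000 * profile_defect (14/25) (83/100) (-19/50) (29/50) (191/500) x =
      1525824 * (1 - x)^6
        + 7700715 * (2 * x - 1) * (1 - x)^5
        + 17304029 * (2 * x - 1)^2 * (1 - x)^4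
        + 18740671 * (2 * x - 1)^3 * (1 - x)^3
        + 9450548 * (2 * x - 1)^4 * (1 - x)^2
        + 1886532 * (2 * x - 1)^5 * (1 - x)
        + 69291 * (2 * x - 1)^6"
      unfolding profile_defect_def profile_def by (simp add: field_simps) algebra
    moreover have "\<dots> \<ge> 0" using x False by (intro add_nonneg_nonneg mult_nonneg_nonneg zero_le_power) auto
    ultimately show ?thesis by simp
  qed
qed

lemma profile_defect_nonneg_2:
  assumes x: "0 \<le> x" "x \<le> 1" and n: "59/200 \<le> n" "n \<le> 69/200"
  shows "profile_defect (49/100) (97/100) (-9/20) (51/100) n x \<ge> 0"
proof (rule profile_defect_nonneg_between[OF n])
  show "profile_defect (49/100) (97/100) (-9/20) (51/100) (59/200) x \<ge> 0"
  proof -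
    have "4000000 * profile_defect (49/100) (97/100) (-9/20) (51/100) (59/200) x =
      11800 * (1 - x)^6
        + 611319 * x * (1 - x)^5
        + 1296631 * x^2 * (1 - x)^4
        + 1290998 * x^3 * (1 - x)^3
        + 2850737 * x^4 * (1 - x)^2
        + 1711394 * x^5 * (1 - x)
        + 51918 * x^6"
      unfolding profile_defect_def profile_def by (simp add: field_simps) algebra
    moreover have "\<dots> \<ge> 0" using x by (intro add_nonneg_nonneg mult_nonneg_nonneg zero_le_power) auto
    ultimately show ?thesis by simp
  qed
  show "profile_defect (49/100) (97/100) (-9/20) (51/100) (69/200) x \<ge> 0"
  proof (cases "x \<le> 1/2")
    case True
    have "4000000 * profile_defect (49/100) (97/100) (-9/20) (51/100) (69/200) x =
      13800 * (1 - 2 * x)^6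
        + 465529 * x * (1 - 2 * x)^5
        + 1996366 * x^2 * (1 - 2 * x)^4
        + 2180392 * x^3 * (1 - 2 * x)^3
        + 60437 * x^4 * (1 - 2 * x)^2
        + 657371 * x^5 * (1 - 2 * x)
        + 1286627 * x^6"
      unfolding profile_defect_def profile_def by (simp add: field_simps) algebra
    moreover have "\<dots> \<ge> 0" using x True by (intro add_nonneg_nonneg mult_nonneg_nonneg zero_le_power) auto
    ultimately show ?thesis by simp
  next
    case False
    have "4000000 * profile_defect (49/100) (97/100) (-9/20) (51/100) (69/200) x =
      1286627 * (1 - x)^6
        + 7062391 * (2 * x - 1) * (1 - x)^5
        + 16072987 * (2 * x - 1)^2 * (1 - x)^4
        + 17220186 * (2 * x - 1)^3 * (1 - x)^3
        + 8543507 * (2 * x - 1)^4 * (1 - x)^2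
        + 1660682 * (2 * x - 1)^5 * (1 - x)
        + 53938 * (2 * x - 1)^6"
      unfolding profile_defect_def profile_def by (simp add: field_simps) algebra
    moreover have "\<dots> \<ge> 0" using x False by (intro add_nonneg_nonneg mult_nonneg_nonneg zero_le_power) auto
    ultimately show ?thesis by simp
  qed
qed

lemma profile_defect_nonneg_3:
  assumes x: "0 \<le> x" "x \<le> 1" and n: "23/100 \<le> n" "n \<le> 59/200"
  shows "profile_defect (19/50) (63/50) (-63/100) (41/100) n x \<ge> 0"
proof (rule profile_defect_nonneg_between[OF n])
  show "profile_defect (19/50) (63/50) (-63/100) (41/100) (23/100) x \<ge> 0"
  proof -
    have "2000000 * profile_defect (19/50) (63/50) (-63/100) (41/100) (23/100) x =
      5451 * (1 - x)^6
        + 287534 * x * (1 - x)^5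
        + 847230 * x^2 * (1 - x)^4
        + 1336138 * x^3 * (1 - x)^3
        + 2464844 * x^4 * (1 - x)^2
        + 1262064 * x^5 * (1 - x)
        + 24646 * x^6"
      unfolding profile_defect_def profile_def by (simp add: field_simps) algebra
    moreover have "\<dots> \<ge> 0" using x by (intro add_nonneg_nonneg mult_nonneg_nonneg zero_le_power) auto
    ultimately show ?thesis by simp
  qed
  show "profile_defect (19/50) (63/50) (-63/100) (41/100) (59/200) x \<ge> 0"
  proof (cases "x \<le> 1/2")
    case True
    have "4000000 * profile_defect (19/50) (63/50) (-63/100) (41/100) (59/200) x =
      13983 * (1 - 2 * x)^6
        + 391920 * x * (1 - 2 * x)^5
        + 1481445 * x^2 * (1 - 2 * x)^4
        + 954594 * x^3 * (1 - 2 * x)^3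
        + 84819 * x^4 * (1 - 2 * x)^2
        + 3406446 * x^5 * (1 - 2 * x)
        + 3224631 * x^6"
      unfolding profile_defect_def profile_def by (simp add: field_simps) algebra
    moreover have "\<dots> \<ge> 0" using x True by (intro add_nonneg_nonneg mult_nonneg_nonneg zero_le_power) auto
    ultimately show ?thesis by simp
  next
    case False
    have "4000000 * profile_defect (19/50) (63/50) (-63/100) (41/100) (59/200) x =
      3224631 * (1 - x)^6
        + 15941340 * (2 * x - 1) * (1 - x)^5
        + 31422054 * (2 * x - 1)^2 * (1 - x)^4
        + 29812842 * (2 * x - 1)^3 * (1 - x)^3
        + 13431582 * (2 * x - 1)^4 * (1 - x)^2
        + 2362020 * (2 * x - 1)^5 * (1 - x)
        + 51918 * (2 * x - 1)^6"
      unfolding profile_defect_def profile_def by (simp add: field_simps) algebra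
    moreover have "\<dots> \<ge> 0" using x False by (intro add_nonneg_nonneg mult_nonneg_nonneg zero_le_power) auto
    ultimately show ?thesis by simp
  qed
qed

lemma profile_defect_nonneg_4:
  assumes x: "0 \<le> x" "x \<le> 1" and n: "17/100 \<le> n" "n \<le> 23/100"
  shows "profile_defect (17/100) (7/4) (-81/100) (3/10) n x \<ge> 0"
proof (rule profile_defect_nonneg_between[OF n])
  show "profile_defect (17/100) (7/4) (-81/100) (3/10) (17/100) x \<ge> 0"
  proof -
    have "2000000 * profile_defect (17/100) (7/4) (-81/100) (3/10) (17/100) x =
      10387 * (1 - x)^6
        + 192797 * x * (1 - x)^5
        + 765005 * x^2 * (1 - x)^4
        + 1554090 * x^3 * (1 - x)^3
        + 3405022 * x^4 * (1 - x)^2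
        + 2137356 * x^5 * (1 - x)
        + 261514 * x^6"
      unfolding profile_defect_def profile_def by (simp add: field_simps) algebra
    moreover have "\<dots> \<ge> 0" using x by (intro add_nonneg_nonneg mult_nonneg_nonneg zero_le_power) auto
    ultimately show ?thesis by simp
  qed
  show "profile_defect (17/100) (7/4) (-81/100) (3/10) (23/100) x \<ge> 0"
  proof (cases "x \<le> 1/2")
    case True
    have "2000000 * profile_defect (17/100) (7/4) (-81/100) (3/10) (23/100) x =
      14053 * (1 - 2 * x)^6
        + 225161 * x * (1 - 2 * x)^5
        + 820605 * x^2 * (1 - 2 * x)^4
        + 668580 * x^3 * (1 - 2 * x)^3
        + 1068543 * x^4 * (1 - 2 * x)^2
        + 4261643 * x^5 * (1 - 2 * x)
        + 3528349 * x^6"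
      unfolding profile_defect_def profile_def by (simp add: field_simps) algebra
    moreover have "\<dots> \<ge> 0" using x True by (intro add_nonneg_nonneg mult_nonneg_nonneg zero_le_power) auto
    ultimately show ?thesis by simp
  next
    case False
    have "2000000 * profile_defect (17/100) (7/4) (-81/100) (3/10) (23/100) x =
      3528349 * (1 - x)^6
        + 16908451 * (2 * x - 1) * (1 - x)^5
        + 32685563 * (2 * x - 1)^2 * (1 - x)^4
        + 31556142 * (2 * x - 1)^3 * (1 - x)^3
        + 15534928 * (2 * x - 1)^4 * (1 - x)^2
        + 3546360 * (2 * x - 1)^5 * (1 - x)
        + 276166 * (2 * x - 1)^6"
      unfolding profile_defect_def profile_def by (simp add: field_simps) algebra
    moreover have "\<dots> \<ge> 0" using x False by (intro add_nonneg_nonneg mult_nonneg_nonneg zero_le_power) auto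
    ultimately show ?thesis by simp
  qed
qed

text \<open>The inequality for \<open>S\<close> is what converts the height \<open>n * S^2\<close>
  into the claimed bound in \<open>first_peak_bound\<close>. It is affine in \<open>n\<close> and
  tightest at the left end of each of the four ranges.\<close>

lemma ex_profile:
  assumes n: "17/100 \<le> n" "n \<le> 191/500"
  obtains S c1 c2 c3 where "S > 0" "n * S\<^sup>2 + 3/5 * S * (1 - n) \<le> n"
    "\<And>x. 0 \<le> x \<Longrightarrow> x \<le> 1 \<Longrightarrow> profile_defect c1 c2 c3 S n x \<ge> 0"
proof -
  consider "n \<le> 23/100" | "23/100 \<le> n" "n \<le> 59/200" | "59/200 \<le> n" "n \<le> 69/200" | "69/200 \<le> n"
    by linarith
  then show ?thesis
  proof cases
    case 1
    show ?thesis
      by (rule that[OF _ _ profile_defect_nonneg_4])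
         (use n 1 in \<open>auto simp: power2_eq_square field_simps\<close>)
  next
    case 2
    show ?thesis
      by (rule that[OF _ _ profile_defect_nonneg_3])
         (use n 2 in \<open>auto simp: power2_eq_square field_simps\<close>)
  next
    case 3
    show ?thesis
      by (rule that[OF _ _ profile_defect_nonneg_2])
         (use n 3 in \<open>auto simp: power2_eq_square field_simps\<close>)
  next
    case 4
    show ?thesis
      by (rule that[OF _ _ profile_defect_nonneg_1])
         (use n 4 in \<open>auto simp: power2_eq_square field_simps\<close>)
  qed
qed

text \<open>\<open>l0\<close>, \<open>l1\<close> and \<open>\<kappa>\<close> solve the linear system given by the three coefficients of the slope identity.\<close>

lemma admissible_ratioI:
  assumes "e = 1 / \<rho>" "0 < e" "e < 1" "A > 0"
    and l1: "l1 = (\<eta> * (1 + e\<^sup>2) + 2 * (1 - e)) / (1 + e)\<^sup>2"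
    and l0: "l0 = e * (2 * l1 - \<eta>) / (1 - e)" and \<kappa>: "\<kappa> = (3 * l1 - \<eta>) / 2" "\<kappa> > 0"
    and disc: "(l1 - (1 - e) * (A * \<kappa>\<^sup>2))\<^sup>2 \<le> 4 * (A * \<kappa>\<^sup>2) * (l0 - e * (A * \<kappa>\<^sup>2))"
  shows "admissible_ratio \<eta> A \<rho>"
proof -
  have e: "1 + e \<noteq> 0" "1 - e \<noteq> 0" using assms(2,3) by linarith+
  have q0: "(1 - e) * l0 = e * (2 * l1 - \<eta>)" using l0 e by simp
  have "(1 + e)\<^sup>2 * l1 = \<eta> * (1 + e\<^sup>2) + 2 * (1 - e)" using l1 e by simp
  then have "(1 - e) * ((1 - e) * l1 + 1 - \<kappa> * (1 - e)) = e * (2 * l1 - \<eta>)"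
    unfolding \<kappa>(1) by (simp add: field_simps power2_eq_square)
  then have "(1 - e) * l0 = (1 - e) * ((1 - e) * l1 + 1 - \<kappa> * (1 - e))"
    using q0 by simp
  then have q1: "l0 = (1 - e) * l1 + 1 - \<kappa> * (1 - e)"
    using e by simp
  have "(e * l1 + (1 - e) * l0) / 2 + ((1 - e) * l1 - l0) * y - 3 * l1 * y\<^sup>2 / 2
        + y + \<eta> * y\<^sup>2 / 2 = \<kappa> * ((1 - y) * (y + e))" for y
  proof -
    have 1: "(e * l1 + (1 - e) * l0) / 2 = \<kappa> * e"
      unfolding q0 \<kappa>(1) by (simp add: field_simps)
    have 2: "(1 - e) * l1 - l0 = \<kappa> * (1 - e) - 1"
      unfolding q1 by simp
    show ?thesis
      unfolding 1 2 \<kappa>(1) by (simp add: field_simps power2_eq_square)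
  qed
  moreover have "A * \<kappa>\<^sup>2 * ((1 - y) * (y + e)) \<le> l0 + l1 * y" for y
  proof -
    define B where "B = A * \<kappa>\<^sup>2"
    have B: "B > 0" using \<kappa> \<open>A > 0\<close> by (simp add: B_def)
    \<comment> \<open>Completing the square: \<open>disc\<close> says that the quadratic
      \<open>l0 + l1 * y - B * ((1 - y) * (y + e))\<close> in \<open>y\<close> has nonpositive
      discriminant.\<close>
    have "0 \<le> (2 * B * y + (l1 - (1 - e) * B))\<^sup>2
        + (4 * B * (l0 - e * B) - (l1 - (1 - e) * B)\<^sup>2)"
      using disc by (simp add: B_def)
    also have "\<dots> = 4 * B * (l0 + l1 * y - B * ((1 - y) * (y + e)))"
      by (simp add: algebra_simps power2_eq_square)
    finally show ?thesis
      using B by (simp add: B_def zero_le_mult_iff)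
  qed
  moreover have "\<rho> > 0"
    using assms(1,2) by simp
  ultimately show ?thesis
    unfolding admissible_ratio_def assms(1)[symmetric] by blast
qed

text \<open>\<open>\<eta> = 1\<close> serves pieces whose right end is a maximum, where
  \<open>v < 1\<close>; \<open>\<eta> = 0\<close> serves those whose right end is a minimum, where
  the quadratic force has the favourable sign after reflection.\<close>

lemma admissible_ratios:
  "admissible_ratio 1 (1/3) 6.05" "admissible_ratio 0 (1/3) 6.14"
  "admissible_ratio 1 (1/2) 4.64" "admissible_ratio 0 (1/2) 4.77"
  "admissible_ratio 1 (2/3) 3.89" "admissible_ratio 0 (2/3) 4.06"
  "admissible_ratio 1 (3/4) 3.63" "admissible_ratio 0 (3/4) 3.81"
  "admissible_ratio 1 1 3.10" "admissible_ratio 0 1 3.30"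
  by (rule admissible_ratioI[OF refl _ _ _ refl refl refl]; simp add: power2_eq_square)+

section \<open>The normalized shock\<close>

text \<open>
  \<open>v = (u - um) / a\<close> and \<open>p = \<epsilon> u' / a\<^sup>2\<close> with \<open>a = (um - up) / 2\<close>. Instead of rescaling the independent
  variable, the speed \<open>c = a / \<epsilon>\<close> is kept, so \<open>p = dv/d(c x)\<close> and \<open>k v'' = v' - v - v\<^sup>2/2\<close> with
  respect to \<open>c x\<close>, where \<open>k = \<delta> a / \<epsilon>\<^sup>2\<close>.
\<close>

locale normalized_shock =
  fixes c k :: real and v p :: "real \<Rightarrow> real" and z :: "nat \<Rightarrow> real"
  assumes c: "c > 0" and k: "k > 0"
    and dv: "\<And>x. (v has_real_derivative c * p x) (at x)"
    and dp: "\<And>x. (p has_real_derivative c * ((p x - v x - (v x)\<^sup>2 / 2) / k)) (at x)"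
    and v_bot: "(v \<longlongrightarrow> 0) at_bot" and v_top: "(v \<longlongrightarrow> - 2) at_top"
    and p_bot: "(p \<longlongrightarrow> 0) at_bot" and p_top: "(p \<longlongrightarrow> 0) at_top"
    and z_less: "\<And>i j. i < j \<Longrightarrow> z j < z i"
    and z_range: "range z = {x. local_extremum_at v x}"
begin

section \<open>Energy and a priori bounds\<close>

definition energy :: "real \<Rightarrow> real" where
  "energy x = k * (p x)\<^sup>2 / 2 + (v x)\<^sup>2 / 2 + (v x)^3 / 6"

lemma isCont_v: "isCont v x" and isCont_p: "isCont p x"
  by (rule DERIV_isCont[OF dv], rule DERIV_isCont[OF dp])

lemma z_less_iff: "z j < z i \<longleftrightarrow> i < j"
  using z_less[of i j] z_less[of j i] by (cases i j rule: linorder_cases) auto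

lemma energy_deriv: "(energy has_real_derivative c * (p x)\<^sup>2) (at x)"
proof -
  have "(energy has_real_derivative k * (2 * p x * (c * ((p x - v x - (v x)\<^sup>2 / 2) / k))) / 2
      + 2 * v x * (c * p x) / 2 + 3 * (v x)\<^sup>2 * (c * p x) / 6) (at x)"
    unfolding energy_def by (auto intro!: derivative_eq_intros dv dp)
  then show ?thesis
    by (rule DERIV_cong) (use k in \<open>simp add: field_simps power2_eq_square\<close>)
qed

lemma energy_mono: "x \<le> y \<Longrightarrow> energy x \<le> energy y"
proof (erule DERIV_nonneg_imp_nondecreasing)
  show "\<exists>D. (energy has_real_derivative D) (at t) \<and> 0 \<le> D" for t
    using energy_deriv[of t] c by (intro exI[of _ "c * (p t)\<^sup>2"]) simp
qed

text \<open>
  The extrema have order type \<open>\<omega>*\<close>, so \<open>v\<close> is not constant on an interval; this replaces an appeal to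
  uniqueness for the differential equation.
\<close>

lemma energy_less:
  assumes "x < y"
  shows "energy x < energy y"
proof (rule ccontr)
  assume "\<not> energy x < energy y"
  then have const: "energy t = energy x" if "x < t" "t < y" for t
    using energy_mono[of x t] energy_mono[of t y] that by simp
  have p0: "p t = 0" if t: "x < t" "t < y" for t
  proof -
    have "(energy has_real_derivative 0) (at t)"
      by (rule has_field_derivative_transform_within_open[of "\<lambda>_. energy x" _ _ "{x<..<y}"])
         (use t const in auto)
    then show ?thesis
      using DERIV_unique[OF energy_deriv] c by fastforce
  qed
  have v_const: "v s = v t" if "x < s" "s < y" "x < t" "t < y" for s t
  proof (rule DERIV_isconst3[where f = v, OF assms])
    show "(v has_real_derivative 0) (at u)" if "u \<in> {x<..<y}" for u
      using dv[of u] p0[of u] that by simp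
  qed (use that in auto)
  \<comment> \<open>Extrema are defined by weak inequalities, so every point of an interval of
    constancy is one.\<close>
  have extremum: "t \<in> range z" if t: "x < t" "t < y" for t
  proof -
    have "\<forall>\<^sub>F s in at t. s \<in> {x<..<y}"
      using t by (intro eventually_at_in_open') auto
    then have "\<forall>\<^sub>F s in at t. v s \<le> v t"
      by (rule eventually_mono) (use v_const[OF _ _ t] in \<open>simp add: eq_refl\<close>)
    then show ?thesis
      unfolding z_range local_extremum_at_def by blast
  qed
  have "(x + y) / 2 \<in> range z"
    using assms by (intro extremum) auto
  then obtain i where i: "z i = (x + y) / 2" by (metis imageE)
  \<comment> \<open>\<open>t\<close> lies strictly between two consecutive extrema, yet it would
    have to be an extremum itself.\<close>
  define t where "t = (max x (z (Suc i)) + z i) / 2"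
  have t: "x < t" "t < y" "z (Suc i) < t" "t < z i"
    using i assms z_less[of i "Suc i"] by (auto simp: t_def)
  then obtain j where "z j = t" using extremum by blast
  then show False
    using t z_less_iff[of j i] z_less_iff[of "Suc i" j] by simp
qed

lemma energy_bot: "(energy \<longlongrightarrow> 0) at_bot"
proof -
  have "(energy \<longlongrightarrow> k * 0\<^sup>2 / 2 + 0\<^sup>2 / 2 + 0^3 / 6) at_bot"
    unfolding energy_def by (intro tendsto_intros v_bot p_bot) auto
  then show ?thesis by simp
qed

lemma energy_top: "(energy \<longlongrightarrow> 2 / 3) at_top"
proof -
  have "(energy \<longlongrightarrow> k * 0\<^sup>2 / 2 + (- 2)\<^sup>2 / 2 + (- 2)^3 / 6) at_top"
    unfolding energy_def by (intro tendsto_intros v_top p_top) auto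
  then show ?thesis by simp
qed

lemma energy_pos: "energy x > 0"
proof -
  have "energy (x - 1) \<ge> 0"
    using energy_bot
    by (rule tendsto_upperbound) (auto intro!: eventually_at_bot_linorderI[of "x - 1"] energy_mono)
  then show ?thesis using energy_less[of "x - 1" x] by simp
qed

lemma energy_less_top: "energy x < 2 / 3"
proof -
  have "energy (x + 1) \<le> 2 / 3"
    using energy_top
    by (rule tendsto_lowerbound) (auto intro!: eventually_at_top_linorderI[of "x + 1"] energy_mono)
  then show ?thesis using energy_less[of x "x + 1"] by simp
qed

text \<open>Energy below \<open>2/3\<close> gives \<open>(v - 1) * (v + 2)^2 < 0\<close>. This
  excludes \<open>v \<ge> 1\<close> and \<open>v = - 2\<close>; since \<open>v\<close> is near
  \<open>0\<close> far to the left, continuity keeps it above \<open>- 2\<close>.\<close>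

lemma v_bounds: "- 2 < v x" "v x < 1"
proof -
  have key: "(v x - 1) * (v x + 2)\<^sup>2 < 0" for x
  proof -
    have "k * (p x)\<^sup>2 / 2 \<ge> 0" using k by simp
    then have "(v x)\<^sup>2 / 2 + (v x)^3 / 6 < 2 / 3"
      using energy_less_top[of x] unfolding energy_def by linarith
    moreover have "(v x - 1) * (v x + 2)\<^sup>2 = 6 * ((v x)\<^sup>2 / 2 + (v x)^3 / 6 - 2 / 3)"
      by (simp add: field_simps power2_eq_square power3_eq_cube)
    ultimately show ?thesis by simp
  qed
  show "v x < 1" using key[of x] by (simp add: mult_less_0_iff)
  have ne: "v y \<noteq> - 2" for y using key[of y] by auto
  show "- 2 < v x"
  proof (rule ccontr)
    assume "\<not> - 2 < v x"
    have "\<forall>\<^sub>F y in at_bot. v y > - 2"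
      by (intro order_tendstoD[OF v_bot]) auto
    then obtain Y where Y: "\<And>y. y \<le> Y \<Longrightarrow> v y > - 2"
      unfolding eventually_at_bot_linorder by blast
    have "min Y x \<le> x" "v (min Y x) \<ge> - 2" using Y[of "min Y x"] by auto
    then have "\<exists>y\<ge>min Y x. y \<le> x \<and> v y = - 2"
      using \<open>\<not> - 2 < v x\<close> isCont_v by (intro IVT2) auto
    then show False using ne by blast
  qed
qed

section \<open>Critical points and alternation of the extrema\<close>

lemma v_nonzero:
  assumes "p x = 0"
  shows "v x \<noteq> 0"
  using energy_pos[of x] assms by (auto simp: energy_def)

text \<open>At a zero of \<open>p\<close> its derivative is
  \<open>- (c / k) * v * (1 + v / 2)\<close>, which is nonzero since \<open>v \<noteq> 0\<close> and
  \<open>v > - 2\<close>. So \<open>p\<close> changes sign there. The converse is Fermat's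
  criterion.\<close>

lemma p_zero_iff: "p x = 0 \<longleftrightarrow> x \<in> range z"
proof
  assume p0: "p x = 0"
  have dp0: "(p has_real_derivative c / k * (1 + v x / 2) * - v x) (at x)"
    by (rule DERIV_cong[OF dp]) (use p0 k in \<open>simp add: field_simps power2_eq_square\<close>)
  have fac: "c / k * (1 + v x / 2) > 0" using v_bounds[of x] c k by simp
  \<comment> \<open>The sign \<open>s\<close> treats maxima (\<open>s = 1\<close>) and minima
    (\<open>s = - 1\<close>) together.\<close>
  have ext: "local_extremum_at v x"
    if "d > 0" and sgn: "s = 1 \<or> s = - 1"
      and right: "\<And>h. 0 < h \<Longrightarrow> h < d \<Longrightarrow> s * p (x + h) < 0"
      and left: "\<And>h. 0 < h \<Longrightarrow> h < d \<Longrightarrow> s * p (x - h) > 0" for d s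
  proof -
    have le: "s * v y \<le> s * v x" if y: "\<bar>y - x\<bar> < d" for y
    proof (cases "y \<le> x")
      case True
      show ?thesis
      proof (rule DERIV_nonneg_imp_nondecreasing[where f = "\<lambda>t. s * v t", OF True])
        fix t assume t: "y \<le> t" "t \<le> x"
        have "s * p t \<ge> 0" using left[of "x - t"] t y p0 by (cases "t = x") auto
        then show "\<exists>D. ((\<lambda>t. s * v t) has_real_derivative D) (at t) \<and> 0 \<le> D"
          using c by (intro exI[of _ "s * (c * p t)"] conjI DERIV_cmult dv)
            (auto simp: zero_le_mult_iff mult.left_commute)
      qed
    next
      case False
      show ?thesis
      proof (rule DERIV_nonpos_imp_nonincreasing[of x y "\<lambda>t. s * v t"])
        fix t assume t: "x \<le> t" "t \<le> y"
        have "s * p t \<le> 0" using right[of "t - x"] t y p0 by (cases "t = x") auto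
        then show "\<exists>D. ((\<lambda>t. s * v t) has_real_derivative D) (at t) \<and> D \<le> 0"
          using c by (intro exI[of _ "s * (c * p t)"] conjI DERIV_cmult dv)
            (auto simp: mult_le_0_iff mult.left_commute)
      qed (use False in simp)
    qed
    have "\<forall>\<^sub>F y in at x. \<bar>y - x\<bar> < d"
      unfolding eventually_at using \<open>d > 0\<close> by (auto simp: dist_real_def)
    then have "\<forall>\<^sub>F y in at x. s * v y \<le> s * v x"
      by (rule eventually_mono) (rule le)
    then show ?thesis
      using sgn unfolding local_extremum_at_def by auto
  qed
  consider "v x > 0" | "v x < 0" using v_nonzero[OF p0] by linarith
  then have "local_extremum_at v x"
  proof cases
    case 1
    then have neg: "c / k * (1 + v x / 2) * - v x < 0"
      by (intro mult_pos_neg[OF fac]) simp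
    obtain d1 where d1: "d1 > 0" "\<And>h. 0 < h \<Longrightarrow> h < d1 \<Longrightarrow> p (x + h) < 0"
      using has_real_derivative_neg_dec_right[OF dp0 neg] p0 by auto
    obtain d2 where d2: "d2 > 0" "\<And>h. 0 < h \<Longrightarrow> h < d2 \<Longrightarrow> p (x - h) > 0"
      using has_real_derivative_neg_dec_left[OF dp0 neg] p0 by auto
    show ?thesis
      by (rule ext[of "min d1 d2" 1]) (use d1 d2 in auto)
  next
    case 2
    then have pos: "c / k * (1 + v x / 2) * - v x > 0"
      by (intro mult_pos_pos[OF fac]) simp
    obtain d1 where d1: "d1 > 0" "\<And>h. 0 < h \<Longrightarrow> h < d1 \<Longrightarrow> p (x + h) > 0"
      using has_real_derivative_pos_inc_right[OF dp0 pos] p0 by auto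
    obtain d2 where d2: "d2 > 0" "\<And>h. 0 < h \<Longrightarrow> h < d2 \<Longrightarrow> p (x - h) < 0"
      using has_real_derivative_pos_inc_left[OF dp0 pos] p0 by auto
    show ?thesis
      by (rule ext[of "min d1 d2" "- 1"]) (use d1 d2 in auto)
  qed
  then show "x \<in> range z" by (simp add: z_range)
next
  assume "x \<in> range z"
  then have "local_extremum_at v x" by (simp add: z_range)
  then have "c * p x = 0"
    unfolding local_extremum_at_def
  proof
    assume "\<forall>\<^sub>F y in at x. v y \<le> v x"
    then obtain d where d: "d > 0" "\<And>y. y \<noteq> x \<Longrightarrow> dist y x < d \<Longrightarrow> v y \<le> v x"
      unfolding eventually_at by blast
    then have "\<forall>y. \<bar>x - y\<bar> < d \<longrightarrow> v y \<le> v x"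
      by (metis abs_minus_commute dist_real_def order_refl)
    then show ?thesis using DERIV_local_max[OF dv d(1)] by blast
  next
    assume "\<forall>\<^sub>F y in at x. v x \<le> v y"
    then obtain d where d: "d > 0" "\<And>y. y \<noteq> x \<Longrightarrow> dist y x < d \<Longrightarrow> v x \<le> v y"
      unfolding eventually_at by blast
    then have "\<forall>y. \<bar>x - y\<bar> < d \<longrightarrow> v x \<le> v y"
      by (metis abs_minus_commute dist_real_def order_refl)
    then show ?thesis using DERIV_local_min[OF dv d(1)] by blast
  qed
  then show "p x = 0" using c by simp
qed

lemma p_zero_z: "p (z i) = 0"
  by (simp add: p_zero_iff)

lemma p_nonzero_between:
  assumes "z (Suc i) < x" "x < z i"
  shows "p x \<noteq> 0"
proof
  assume "p x = 0"
  then obtain j where "x = z j" using p_zero_iff by auto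
  then show False using assms by (simp add: z_less_iff)
qed

lemma p_nonzero_right:
  assumes "z 0 < x"
  shows "p x \<noteq> 0"
proof
  assume "p x = 0"
  then obtain j where "x = z j" using p_zero_iff by auto
  then show False using assms by (simp add: z_less_iff)
qed

lemma p_same_sign:
  assumes xy: "x < y" and nz: "\<And>t. x \<le> t \<Longrightarrow> t \<le> y \<Longrightarrow> p t \<noteq> 0"
  shows "p x > 0 \<longleftrightarrow> p y > 0"
proof (rule ccontr)
  assume "\<not> ?thesis"
  then have "(p x \<le> 0 \<and> 0 \<le> p y) \<or> (p x \<ge> 0 \<and> 0 \<ge> p y)" by linarith
  then have "\<exists>t\<ge>x. t \<le> y \<and> p t = 0"
    using IVT[of p x 0 y] IVT2[of p y 0 x] isCont_p xy by auto
  then show False using nz by blast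
qed

text \<open>\<open>p\<close> has constant sign there; a positive sign would make \<open>v\<close>
  increase towards its limit \<open>- 2\<close>, against \<open>v > - 2\<close>.\<close>

lemma p_neg_right:
  assumes "x > z 0"
  shows "p x < 0"
proof (rule ccontr)
  assume "\<not> p x < 0"
  then have px: "p x > 0" using p_nonzero_right[OF assms] by simp
  have pos: "p y > 0" if "y \<ge> x" for y
    using p_same_sign[of x y] p_nonzero_right assms px that by (cases "x = y") auto
  have "v x \<le> v y" if "y \<ge> x" for y
    using that pos c by (intro DERIV_nonneg_imp_nondecreasing[OF that]) (auto intro!: exI dv less_imp_le)
  then have "v x \<le> - 2"
    by (intro tendsto_lowerbound[OF v_top]) (auto intro: eventually_at_top_linorderI[of x])
  then show False using v_bounds[of x] by simp
qed

text \<open>The sign of \<open>p\<close> just right of a critical point fixes the sign of its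
  derivative there, hence that of \<open>v\<close>. The derivative being nonzero, \<open>p\<close>
  has the opposite sign just to the left and keeps it up to the next extremum.\<close>

lemma turning_point:
  assumes s: "s = 1 \<or> s = - 1" and b: "z i < b" and right: "\<And>x. z i < x \<Longrightarrow> x < b \<Longrightarrow> s * p x < 0"
  shows "s * v (z i) > 0" and "\<And>x. z (Suc i) < x \<Longrightarrow> x < z i \<Longrightarrow> s * p x > 0"
proof -
  define D where "D = s * (- (c / k) * (v (z i) * (1 + v (z i) / 2)))"
  have dsp: "((\<lambda>x. s * p x) has_real_derivative D) (at (z i))"
    unfolding D_def
    by (intro DERIV_cmult DERIV_cong[OF dp])
       (use p_zero_z[of i] k in \<open>simp add: field_simps power2_eq_square\<close>)
  have D: "D = c / k * (1 + v (z i) / 2) * - (s * v (z i))"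
    by (simp add: D_def)
  have fac: "c / k * (1 + v (z i) / 2) > 0" using v_bounds[of "z i"] c k by simp
  show pos: "s * v (z i) > 0"
  proof (rule ccontr)
    assume "\<not> s * v (z i) > 0"
    then have "s * v (z i) < 0" using v_nonzero[OF p_zero_z[of i]] s by auto
    then have "D > 0" unfolding D by (intro mult_pos_pos[OF fac]) simp
    then obtain d where d: "d > 0" "\<And>h. 0 < h \<Longrightarrow> h < d \<Longrightarrow> s * p (z i + h) > 0"
      using has_real_derivative_pos_inc_right[OF dsp] p_zero_z[of i] by auto
    define h where "h = min d (b - z i) / 2"
    have "0 < h" "h < d" "z i + h < b" using d(1) b by (auto simp: h_def min_def field_simps)
    then show False using d(2)[of h] right[of "z i + h"] by simp
  qed
  have "D < 0" unfolding D using pos by (intro mult_pos_neg[OF fac]) simp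
  then obtain d where d: "d > 0" "\<And>h. 0 < h \<Longrightarrow> h < d \<Longrightarrow> s * p (z i - h) > 0"
    using has_real_derivative_neg_dec_left[OF dsp] p_zero_z[of i] by auto
  fix x assume x: "z (Suc i) < x" "x < z i"
  define h where "h = min d (z i - x) / 2"
  have h: "0 < h" "h < d" "x < z i - h" using d(1) x by (auto simp: h_def min_def field_simps)
  have "p x > 0 \<longleftrightarrow> p (z i - h) > 0"
    using h x by (intro p_same_sign p_nonzero_between[of i]) auto
  moreover have "p x \<noteq> 0" "p (z i - h) \<noteq> 0"
    using h x p_nonzero_between[of i x] p_nonzero_between[of i "z i - h"] by auto
  ultimately show "s * p x > 0"
    using d(2)[OF h(1,2)] s by auto
qed

text \<open>Induction from right to left: \<open>p_neg_right\<close> starts it, and each turning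
  point passes the reversed sign on to the next piece.\<close>

lemma alternation:
  "(- 1)^i * v (z i) > 0 \<and> (\<forall>x. z (Suc i) < x \<and> x < z i \<longrightarrow> (- 1)^i * p x > 0)"
proof (induction i)
  case 0
  show ?case
    using turning_point[of 1 0 "z 0 + 1"] p_neg_right by auto
next
  case (Suc i)
  have s: "(- 1 :: real) ^ Suc i = 1 \<or> (- 1 :: real) ^ Suc i = - 1"
    by (metis minus_one_power_iff)
  have lt: "z (Suc i) < z i" using z_less by simp
  have neg: "(- 1) ^ Suc i * p x < 0" if "z (Suc i) < x" "x < z i" for x
    using Suc that by simp
  show ?case
    using turning_point[OF s lt neg] by blast
qed

section \<open>Decay ratios and peak bound in normalized form\<close>

lemma ratio_max_min:
  assumes i: "odd i" and "k \<le> A" "admissible_ratio 1 A \<rho>"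
  shows "v (z (i - 1)) / - v (z i) \<ge> \<rho>"
proof -
  \<comment> \<open>Oddness gives \<open>i \<ge> 1\<close>, so \<open>i - 1\<close> is not
    truncated.\<close>
  obtain j where j: "i = Suc j" "even j" using i by (cases i) auto
  have v: "v (z j) > 0" "v (z i) < 0" and p: "\<And>x. z i < x \<Longrightarrow> x < z j \<Longrightarrow> p x > 0"
    using alternation[of j] alternation[of i] j i by auto
  have "- v (z i) * \<rho> \<le> v (z j)"
    by (rule half_swing[where P = p and \<theta> = 1 and \<eta> = 1, OF _ c k])
       (use assms j v p dv dp p_zero_z z_less v_bounds[of "z j"] in auto)
  then show ?thesis using v j by (simp add: field_simps)
qed

text \<open>Reflecting to \<open>Y = - v\<close> gives \<open>\<theta> = - 1\<close>; then
  \<open>\<theta> * Y x1\<close> is negative and \<open>\<eta> = 0\<close> is allowed.\<close>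

lemma ratio_min_max:
  assumes i: "odd i" and "k \<le> A" "admissible_ratio 0 A \<rho>"
  shows "- v (z i) / v (z (i + 1)) \<ge> \<rho>"
proof -
  have v: "v (z i) < 0" "v (z (Suc i)) > 0" and p: "\<And>x. z (Suc i) < x \<Longrightarrow> x < z i \<Longrightarrow> p x < 0"
    using alternation[of i] alternation[of "Suc i"] i by auto
  have "- (- v (z (Suc i))) * \<rho> \<le> - v (z i)"
  proof (rule half_swing[where Y = "\<lambda>x. - v x" and P = "\<lambda>x. - p x" and \<theta> = "- 1" and \<eta> = 0, OF _ c k])
    show "((\<lambda>x. - v x) has_real_derivative c * - p x) (at x)" for x
      using DERIV_minus[OF dv] by simp
    show "((\<lambda>x. - p x) has_real_derivative c * ((- p x - - v x - - 1 * (- v x)\<^sup>2 / 2) / k)) (at x)" for x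
      by (rule DERIV_cong[OF DERIV_minus[OF dp]]) (use k in \<open>simp add: field_simps\<close>)
  qed (use assms v p p_zero_z z_less in auto)
  then show ?thesis using v by (simp add: field_simps)
qed

text \<open>The claimed bound is \<open>nA * S^2\<close> for the positive root \<open>S\<close> of
  \<open>nA * S^2 + 3/5 * S * (1 - nA) = nA\<close>, where \<open>nA\<close> is the value of
  \<open>n\<close> at \<open>k = A\<close>.\<close>

lemma first_peak_bound:
  assumes k14: "1/4 < k" and kA: "k < A" and A1: "A \<le> 1"
  shows "v (z 0) \<le> 1 / (100 * A) * (sqrt (9 + 25 * (sqrt (1 + 4 * A) - 1)\<^sup>2) - 3)\<^sup>2"
proof -
  define q Q where "q = sqrt (1 + 4 * k)" and "Q = sqrt (1 + 4 * A)"
  have A: "A > 0" using k14 kA by simp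
  have q2: "q\<^sup>2 = 1 + 4 * k" and Q2: "Q\<^sup>2 = 1 + 4 * A"
    using k A by (simp_all add: q_def Q_def)
  \<comment> \<open>\<open>k\<close> between \<open>1/4\<close> and \<open>1\<close> puts
    \<open>q\<close> between \<open>sqrt 2\<close> and \<open>sqrt 5\<close>; these rational bounds
    give the range of \<open>n\<close> in \<open>ex_profile\<close>.\<close>
  have q_low: "q \<ge> 141/100"
    unfolding q_def using k14 by (intro real_le_rsqrt) (simp add: power2_eq_square)
  have q_up: "q \<le> 22361/10000"
    unfolding q_def using kA A1 by (intro real_le_lsqrt) (auto simp: power2_eq_square)
  have qQ: "q \<le> Q" using kA by (simp add: q_def Q_def)
  define n where "n = (q - 1) / (q + 1)"
  define nA where "nA = (Q - 1) / (Q + 1)"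
  have n: "17/100 \<le> n" "n \<le> 191/500"
    using q_low q_up by (auto simp: n_def field_simps)
  have n_nA: "n \<le> nA"
    using q_low qQ by (simp add: n_def nA_def field_simps)
  obtain S c1 c2 c3 where S: "S > 0" and nS: "n * S\<^sup>2 + 3/5 * S * (1 - n) \<le> n"
    and defect: "\<And>x. 0 \<le> x \<Longrightarrow> x \<le> 1 \<Longrightarrow> profile_defect c1 c2 c3 S n x \<ge> 0"
    by (rule ex_profile[OF n]) (rule that; (assumption | simp))
  \<comment> \<open>The positive root of \<open>k * m^2 + m = 1\<close>.\<close>
  define m where "m = 2 / (q + 1)"
  have m: "m > 0" "n = 1 - m" using q_low by (auto simp: m_def n_def field_simps)
  have kq: "k = (q - 1) * (q + 1) / 4" using q2 by (simp add: power2_eq_square algebra_simps)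
  have mq: "m * (q + 1) = 2" using q_low by (simp add: m_def field_simps)
  have "k * m\<^sup>2 = m * (q + 1) * (m * (q + 1) - 2 * m) / 4"
    unfolding kq by (simp add: power2_eq_square algebra_simps)
  then have km: "k * m\<^sup>2 = 1 - m" unfolding mq by simp
  have peak: "v (z 0) \<le> n * S\<^sup>2"
    by (rule first_peak[OF c k m(1) km dv dp v_top p_top v_bounds(1) p_neg_right S m(2) _ defect])
      (use n in auto)
  have AQ: "A = (Q - 1) * (Q + 1) / 4" using Q2 by (simp add: power2_eq_square algebra_simps)
  have Q: "Q > 1" using q_low qQ by simp
  have nAQ: "nA * (Q + 1) = Q - 1" using Q by (simp add: nA_def)
  have "A * nA = (Q - 1) * (nA * (Q + 1)) / 4"
    unfolding AQ by simp
  then have AnA: "A * nA = ((Q - 1) / 2)\<^sup>2"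
    unfolding nAQ by (simp add: power2_eq_square)
  have "A * (1 - nA) = (Q - 1) * (Q + 1 - nA * (Q + 1)) / 4"
    unfolding AQ by (simp add: algebra_simps)
  then have half: "(Q - 1) / 2 = A * (1 - nA)"
    unfolding nAQ by simp
  \<comment> \<open>At \<open>n = nA\<close> both \<open>T\<close> and \<open>A * (1 - n)\<close>
    equal \<open>(Q - 1) / 2\<close>; monotonicity in \<open>n\<close> then gives
    \<open>T \<le> A * (1 - n)\<close>.\<close>
  define T where "T = sqrt (A * n)"
  have T: "T \<ge> 0" "T\<^sup>2 = A * n" using A n by (simp_all add: T_def)
  have "T \<le> (Q - 1) / 2"
    unfolding T_def
  proof (rule real_le_lsqrt)
    show "A * n \<le> ((Q - 1) / 2)\<^sup>2"
      unfolding AnA[symmetric] using n_nA A by (intro mult_left_mono) auto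
  qed (use Q in auto)
  also have "\<dots> \<le> A * (1 - n)"
    unfolding half using n_nA A by simp
  finally have T_le: "T \<le> A * (1 - n)" .
  have "(10 * S * T + 3)\<^sup>2 \<le> 9 + 25 * (Q - 1)\<^sup>2"
  proof -
    have "(10 * S * T + 3)\<^sup>2 = 9 + 100 * S\<^sup>2 * (A * n) + 60 * S * T"
      unfolding T(2)[symmetric] by (simp add: power2_eq_square algebra_simps)
    also have "\<dots> \<le> 9 + 100 * S\<^sup>2 * (A * n) + 60 * S * (A * (1 - n))"
      using T_le S by (intro add_left_mono mult_left_mono) auto
    also have "\<dots> = 9 + 100 * A * (n * S\<^sup>2 + 3/5 * S * (1 - n))"
      by (simp add: field_simps)
    also have "\<dots> \<le> 9 + 100 * A * nA"
      using nS n_nA A by (intro add_left_mono mult_left_mono) auto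
    also have "\<dots> = 9 + 25 * (Q - 1)\<^sup>2"
      using AnA by (simp add: power2_eq_square)
    finally show ?thesis .
  qed
  then have "10 * S * T + 3 \<le> sqrt (9 + 25 * (Q - 1)\<^sup>2)"
    by (rule real_le_rsqrt)
  then have "(10 * S * T)\<^sup>2 \<le> (sqrt (9 + 25 * (Q - 1)\<^sup>2) - 3)\<^sup>2"
    using S T by (intro power_mono) auto
  then have "100 * A * (n * S\<^sup>2) \<le> (sqrt (9 + 25 * (Q - 1)\<^sup>2) - 3)\<^sup>2"
    by (simp add: power_mult_distrib T(2) mult_ac)
  then have "n * S\<^sup>2 \<le> 1 / (100 * A) * (sqrt (9 + 25 * (Q - 1)\<^sup>2) - 3)\<^sup>2"
    using A by (simp add: field_simps)
  then show ?thesis using peak unfolding Q_def by linarith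
qed

end

section \<open>The shock in the original variables\<close>

text \<open>The quotient \<open>f x / x\<close> tends to \<open>l\<close> by l'Hopital and to
  \<open>0\<close> because \<open>f\<close> converges.\<close>

lemma deriv_limit_zero_at_top:
  fixes f f' :: "real \<Rightarrow> real"
  assumes "(f \<longlongrightarrow> L) at_top" "(f' \<longlongrightarrow> l) at_top"
    and "\<And>x. (f has_real_derivative f' x) (at x)"
  shows "l = 0"
proof -
  have "((\<lambda>x. f x / x) \<longlongrightarrow> l) at_top"
    by (rule lhospital_at_top_at_top[where f' = f' and g' = "\<lambda>_. 1"])
       (use assms in \<open>auto intro: filterlim_ident\<close>)
  moreover have "((\<lambda>x. f x / x) \<longlongrightarrow> 0) at_top"
    by (rule tendsto_divide_0[OF assms(1)])
       (auto intro: filterlim_at_top_imp_at_infinity filterlim_ident)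
  ultimately show ?thesis
    using tendsto_unique trivial_limit_at_top_linorder by blast
qed

lemma shock_normalized:
  assumes \<epsilon>: "\<epsilon> > 0" and \<delta>: "\<delta> > 0" and um: "um > up"
    and shock: "viscous_dispersive_shock \<epsilon> \<delta> um up u" and ext: "extrema_from_right u \<xi>"
  defines "a \<equiv> (um - up) / 2"
  shows "normalized_shock (a / \<epsilon>) (\<delta> * a / \<epsilon>\<^sup>2) (\<lambda>x. (u x - um) / a)
    (\<lambda>x. \<epsilon> / a\<^sup>2 * deriv u x) \<xi>"
proof -
  have a: "a > 0" using um by (simp add: a_def)
  define \<sigma> where "\<sigma> = (um + up) / 2"
  define u1 u2 u3 where "u1 = deriv u" and "u2 = deriv u1" and "u3 = deriv u2"
  have smooth: "(deriv ^^ j) u differentiable (at x)" for j x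
    using shock by (simp add: viscous_dispersive_shock_def)
  have d0: "(u has_real_derivative u1 x) (at x)"
    and d1: "(u1 has_real_derivative u2 x) (at x)"
    and d2: "(u2 has_real_derivative u3 x) (at x)" for x
    using smooth[of 0 x] smooth[of 1 x] smooth[of 2 x]
    by (simp_all add: u1_def u2_def u3_def DERIV_deriv_iff_real_differentiable numeral_2_eq_2)
  have "deriv (\<lambda>y. (u y)\<^sup>2 / 2) x = u x * u1 x" for x
    by (rule DERIV_imp_deriv) (auto intro!: derivative_eq_intros d0)
  then have ode: "- \<sigma> * u1 x + u x * u1 x = \<epsilon> * u2 x - \<delta> * u3 x" for x
    using shock by (simp add: viscous_dispersive_shock_def \<sigma>_def u1_def u2_def u3_def)
  \<comment> \<open>The first integral of the profile equation.\<close>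
  define G where "G x = - \<sigma> * u x + (u x)\<^sup>2 / 2 - \<epsilon> * u1 x + \<delta> * u2 x" for x
  have dG: "(G has_real_derivative 0) (at x)" for x
  proof -
    have "(G has_real_derivative - \<sigma> * u1 x + u x * u1 x - \<epsilon> * u2 x + \<delta> * u3 x) (at x)"
      unfolding G_def by (auto intro!: derivative_eq_intros d0 d1 d2)
    then show ?thesis using ode[of x] by simp
  qed
  define C where "C = G 0"
  have G_C: "G x = C" for x
    unfolding C_def using DERIV_isconst_all dG by blast
  have u2_eq: "u2 x = (C + \<sigma> * u x - (u x)\<^sup>2 / 2 + \<epsilon> * u1 x) / \<delta>" for x
    using G_C[of x] \<delta> by (simp add: G_def field_simps)
  have lims: "(u \<longlongrightarrow> um) at_bot" "(u \<longlongrightarrow> up) at_top" "(u1 \<longlongrightarrow> 0) at_bot" "(u1 \<longlongrightarrow> 0) at_top"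
    using shock by (simp_all add: viscous_dispersive_shock_def u1_def)
  \<comment> \<open>The integrated equation gives \<open>u2\<close> a limit at the right end; as
    \<open>u1\<close> converges, that limit is \<open>0\<close>, which determines
    \<open>C\<close>.\<close>
  have "(u2 \<longlongrightarrow> (C + \<sigma> * up - up\<^sup>2 / 2 + \<epsilon> * 0) / \<delta>) at_top"
    unfolding u2_eq using \<delta> by (intro tendsto_intros lims) auto
  then have "(C + \<sigma> * up - up\<^sup>2 / 2 + \<epsilon> * 0) / \<delta> = 0"
    by (rule deriv_limit_zero_at_top[OF lims(4) _ d1])
  then have C: "C = up\<^sup>2 / 2 - \<sigma> * up" using \<delta> by simp
  \<comment> \<open>Since \<open>\<sigma>\<close> is the mean of the end states, this
    \<open>C\<close> makes \<open>um\<close> a zero of the quadratic as well.\<close>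
  have u2_factor: "\<delta> * u2 x = \<epsilon> * u1 x - a * (u x - um) - (u x - um)\<^sup>2 / 2" for x
    unfolding u2_eq C using \<delta> by (simp add: \<sigma>_def a_def field_simps power2_eq_square)
  define v where "v x = (u x - um) / a" for x
  define p where "p x = \<epsilon> / a\<^sup>2 * u1 x" for x
  have "normalized_shock (a / \<epsilon>) (\<delta> * a / \<epsilon>\<^sup>2) v p \<xi>"
  proof
    show "a / \<epsilon> > 0" "\<delta> * a / \<epsilon>\<^sup>2 > 0" using a \<epsilon> \<delta> by simp_all
    show "(v has_real_derivative a / \<epsilon> * p x) (at x)" for x
    proof -
      have "(v has_real_derivative u1 x / a) (at x)"
        unfolding v_def using a by (auto intro!: derivative_eq_intros d0)
      then show ?thesis
        by (rule DERIV_cong) (use a \<epsilon> in \<open>simp add: p_def power2_eq_square\<close>)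
    qed
    show "(p has_real_derivative a / \<epsilon> * ((p x - v x - (v x)\<^sup>2 / 2) / (\<delta> * a / \<epsilon>\<^sup>2))) (at x)" for x
    proof -
      have "(p has_real_derivative \<epsilon> / a\<^sup>2 * u2 x) (at x)"
        unfolding p_def by (intro DERIV_cmult d1)
      moreover have "\<epsilon> / a\<^sup>2 * u2 x = \<epsilon> / (\<delta> * a\<^sup>2) * (\<delta> * u2 x)"
        using \<delta> by simp
      moreover have "\<dots> = a / \<epsilon> * ((p x - v x - (v x)\<^sup>2 / 2) / (\<delta> * a / \<epsilon>\<^sup>2))"
        unfolding u2_factor p_def v_def using a \<epsilon> \<delta> by (simp add: field_simps power2_eq_square)
      ultimately show ?thesis by simp
    qed
    have "(v \<longlongrightarrow> (um - um) / a) at_bot" "(v \<longlongrightarrow> (up - um) / a) at_top"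
      unfolding v_def using a by (intro tendsto_intros lims; simp)+
    moreover have "(up - um) / a = - 2" using um by (simp add: a_def field_simps)
    ultimately show "(v \<longlongrightarrow> 0) at_bot" "(v \<longlongrightarrow> - 2) at_top" by simp_all
    have "(p \<longlongrightarrow> \<epsilon> / a\<^sup>2 * 0) at_bot" "(p \<longlongrightarrow> \<epsilon> / a\<^sup>2 * 0) at_top"
      unfolding p_def by (intro tendsto_intros lims)+
    then show "(p \<longlongrightarrow> 0) at_bot" "(p \<longlongrightarrow> 0) at_top" by simp_all
    show "\<xi> j < \<xi> i" if "i < j" for i j
      using ext that by (simp add: extrema_from_right_def)
    have "local_extremum_at v = local_extremum_at u"
      using a by (simp add: fun_eq_iff local_extremum_at_def v_def divide_le_cancel)
    then show "range \<xi> = {x. local_extremum_at v x}"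
      using ext by (simp add: extrema_from_right_def)
  qed
  then show ?thesis unfolding v_def p_def u1_def .
qed

lemma shock_estimates:
  assumes \<epsilon>: "\<epsilon> > 0" and \<delta>: "\<delta> > 0" and um: "um > up"
    and low: "1/4 < \<delta> * (um - up) / (2 * \<epsilon>\<^sup>2)"
    and high: "\<delta> * (um - up) / (2 * \<epsilon>\<^sup>2) < A" and A: "A \<le> 1"
    and shock: "viscous_dispersive_shock \<epsilon> \<delta> um up u" and ext: "extrema_from_right u \<xi>"
  shows "u (\<xi> 0) - um \<le> (um - up) / 2 * (1 / (100 * A)) *
      (sqrt (9 + 25 * (sqrt (1 + 4 * A) - 1)\<^sup>2) - 3)\<^sup>2"
    and "odd i \<Longrightarrow> admissible_ratio 1 B \<rho> \<Longrightarrow> A \<le> B \<Longrightarrow>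
      (u (\<xi> (i - 1)) - um) / (um - u (\<xi> i)) \<ge> \<rho>"
    and "odd i \<Longrightarrow> admissible_ratio 0 B \<rho> \<Longrightarrow> A \<le> B \<Longrightarrow>
      (um - u (\<xi> i)) / (u (\<xi> (i + 1)) - um) \<ge> \<rho>"
proof -
  define a where "a = (um - up) / 2"
  have a: "a > 0" using um by (simp add: a_def)
  define k where "k = \<delta> * a / \<epsilon>\<^sup>2"
  define v where "v x = (u x - um) / a" for x
  have "\<delta> * (um - up) / (2 * \<epsilon>\<^sup>2) = k" by (simp add: k_def a_def)
  then have k_bounds: "1/4 < k" "k < A" using low high by simp_all
  interpret normalized_shock "a / \<epsilon>" k v "\<lambda>x. \<epsilon> / a\<^sup>2 * deriv u x" \<xi>
    unfolding k_def v_def a_def by (rule shock_normalized[OF \<epsilon> \<delta> um shock ext])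
  have u: "u x - um = a * v x" "um - u x = a * - v x" for x
    using a by (simp_all add: v_def)
  show "u (\<xi> 0) - um \<le> (um - up) / 2 * (1 / (100 * A)) *
      (sqrt (9 + 25 * (sqrt (1 + 4 * A) - 1)\<^sup>2) - 3)\<^sup>2"
    unfolding u a_def[symmetric] mult.assoc
    using first_peak_bound[OF k_bounds A] a by (intro mult_left_mono) auto
  show "(u (\<xi> (i - 1)) - um) / (um - u (\<xi> i)) \<ge> \<rho>"
    if "odd i" "admissible_ratio 1 B \<rho>" "A \<le> B"
    unfolding u using ratio_max_min[of i B \<rho>] that k_bounds a by simp
  show "(um - u (\<xi> i)) / (u (\<xi> (i + 1)) - um) \<ge> \<rho>"
    if "odd i" "admissible_ratio 0 B \<rho>" "A \<le> B"
    unfolding u using ratio_min_max[of i B \<rho>] that k_bounds a by simp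
qed

section \<open>The decay rates as functions of \<open>A\<close>\<close>

definition rate_max_min :: "real \<Rightarrow> real" where
  "rate_max_min A = (if A = 1/3 then 6.05 else if A = 1/2 then 4.64 else
     if A = 2/3 then 3.89 else if A = 3/4 then 3.63 else 3.10)"

definition rate_min_max :: "real \<Rightarrow> real" where
  "rate_min_max A = (if A = 1/3 then 6.14 else if A = 1/2 then 4.77 else
     if A = 2/3 then 4.06 else if A = 3/4 then 3.81 else 3.30)"

lemma rate_values:
  "rate_max_min (1/3) = 6.05" "rate_min_max (1/3) = 6.14"
  "rate_max_min (1/2) = 4.64" "rate_min_max (1/2) = 4.77"
  "rate_max_min (2/3) = 3.89" "rate_min_max (2/3) = 4.06"
  "rate_max_min (3/4) = 3.63" "rate_min_max (3/4) = 3.81"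
  "rate_max_min 1 = 3.10" "rate_min_max 1 = 3.30"
  by (simp_all add: rate_max_min_def rate_min_max_def)

text \<open>A ratio admissible for \<open>B\<close> serves every shock with
  \<open>k \<le> B\<close>. The selected values below \<open>1\<close> take \<open>B = A\<close>;
  all other \<open>A \<le> 1\<close> share the rates of \<open>B = 1\<close>.\<close>

lemma admissible_rates:
  assumes "A \<le> 1"
  obtains B where "A \<le> B" "admissible_ratio 1 B (rate_max_min A)"
    "admissible_ratio 0 B (rate_min_max A)"
proof -
  consider "A = 1/3" | "A = 1/2" | "A = 2/3" | "A = 3/4" | "A \<notin> {1/3, 1/2, 2/3, 3/4}"
    by blast
  then show ?thesis
  proof cases
    case 5
    show ?thesis
      by (rule that[of 1]) (use 5 assms admissible_ratios in \<open>auto simp: rate_max_min_def rate_min_max_def\<close>)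
  qed (rule that[of A]; simp only: rate_values order_refl admissible_ratios)+
qed

theorem theorem2p1:
  shows "\<exists>\<rho>lo \<rho>up :: real \<Rightarrow> real.
    (\<forall>A. 1/4 < A \<and> A \<le> 1 \<longrightarrow> \<rho>lo A > 1 \<and> \<rho>up A > 1) \<and>
    \<rho>lo (1/3) = 6.05 \<and> \<rho>up (1/3) = 6.14 \<and>
    \<rho>lo (1/2) = 4.64 \<and> \<rho>up (1/2) = 4.77 \<and>
    \<rho>lo (2/3) = 3.89 \<and> \<rho>up (2/3) = 4.06 \<and>
    \<rho>lo (3/4) = 3.63 \<and> \<rho>up (3/4) = 3.81 \<and>
    \<rho>lo 1 = 3.10 \<and> \<rho>up 1 = 3.30 \<and>
    (\<forall>(\<epsilon>::real) (\<delta>::real) (um::real) (up::real) (A::real) (u :: real \<Rightarrow> real) (\<xi> :: nat \<Rightarrow> real).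
      \<epsilon> > 0 \<and> \<delta> > 0 \<and> um > up \<and>
      1/4 < \<delta> * (um - up) / (2 * \<epsilon>\<^sup>2) \<and> \<delta> * (um - up) / (2 * \<epsilon>\<^sup>2) < A \<and> A \<le> 1 \<and>
      viscous_dispersive_shock \<epsilon> \<delta> um up u \<and> extrema_from_right u \<xi> \<longrightarrow>
        u (\<xi> 0) - um \<le> (um - up) / 2 * (1 / (100 * A)) *
          (sqrt (9 + 25 * (sqrt (1 + 4 * A) - 1)\<^sup>2) - 3)\<^sup>2 \<and>
        (\<forall>i::nat. odd i \<longrightarrow>
          (u (\<xi> (i - 1)) - um) / (um - u (\<xi> i)) \<ge> \<rho>lo A \<and>
          (um - u (\<xi> i)) / (u (\<xi> (i + 1)) - um) \<ge> \<rho>up A))"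
proof (rule exI[of _ rate_max_min], rule exI[of _ rate_min_max], intro conjI allI impI; (elim conjE)?)
  fix A :: real
  assume "1/4 < A" "A \<le> 1"
  then show "rate_max_min A > 1" "rate_min_max A > 1"
    by (simp_all add: rate_max_min_def rate_min_max_def)
next
  fix \<epsilon> \<delta> um up A :: real and u \<xi>
  assume h: "\<epsilon> > 0" "\<delta> > 0" "um > up"
    "1/4 < \<delta> * (um - up) / (2 * \<epsilon>\<^sup>2)" "\<delta> * (um - up) / (2 * \<epsilon>\<^sup>2) < A" "A \<le> 1"
    "viscous_dispersive_shock \<epsilon> \<delta> um up u" "extrema_from_right u \<xi>"
  obtain B where "A \<le> B" "admissible_ratio 1 B (rate_max_min A)" "admissible_ratio 0 B (rate_min_max A)"
    using h admissible_rates by blast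
  note est = shock_estimates[OF h]
  show "u (\<xi> 0) - um \<le> (um - up) / 2 * (1 / (100 * A)) *
      (sqrt (9 + 25 * (sqrt (1 + 4 * A) - 1)\<^sup>2) - 3)\<^sup>2"
    by (rule est(1))
  fix i :: nat
  assume "odd i"
  show "(u (\<xi> (i - 1)) - um) / (um - u (\<xi> i)) \<ge> rate_max_min A"
    "(um - u (\<xi> i)) / (u (\<xi> (i + 1)) - um) \<ge> rate_min_max A"
    by (rule est; fact)+
qed (simp_all add: rate_max_min_def rate_min_max_def)

end
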